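(* Every monomial almost complete intersection in $S$ is either a dominant ideal or a semidominant ideal.
   Context: $S$ is a polynomial ring in finitely many variables over an arbitrary field. A monomial almost complete intersection is a monomial ideal $M=(l_1,\dots,l_q,l)$ minimally generated by monomials $l_1,\dots,l_q,l$ such that $l_1,\dots,l_q$ form a regular sequence (equivalently, no two of $l_1,\dots,l_q$ have a variable in common). Given a set $G$ of monomials, $m\in G$ is dominant (with respect to $G$) if there are a variable $x$ and an integer $k\ge1$ with $x^k\mid m$ and $x^k\nmid m'$ for all $m'\in G\setminus\{m\}$. A set of monomials is dominant if all its elements are dominant, and semidominant if exactly one of its elements is not dominant. A monomial ideal is dominant (respectively semidominant) if its minimal generating set is dominant (respectively semidominant). *)

theory Defs
  imports Complex_Main "HOL-Library.Poly_Mapping"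
begin

text \<open>
  Polynomials are finitely supported maps from exponent vectors to coefficients; the polynomial
  ring \<open>S\<close> in finitely many variables over a field is \<open>('x, 'k) mpoly\<close> with \<open>'x\<close> of class
  \<open>finite\<close> and \<open>'k\<close> of class \<open>field\<close>.
\<close>

type_synonym ('x, 'k) mpoly = "('x \<Rightarrow>\<^sub>0 nat) \<Rightarrow>\<^sub>0 'k"

definition var :: "'x \<Rightarrow> ('x, 'k::field) mpoly" where
  "var x = Poly_Mapping.single (Poly_Mapping.single x 1) 1"

definition monomials :: "('x, 'k::field) mpoly set" where
  "monomials = range (\<lambda>t. Poly_Mapping.single t 1)"

text \<open>Ideals are the submodules of the ring, seen as a module over itself.\<close>

definition ideal_gen :: "'a::comm_ring_1 set \<Rightarrow> 'a set" where
  "ideal_gen G = module.span (*) G"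

definition regular_sequence :: "'a::comm_ring_1 list \<Rightarrow> bool" where
  "regular_sequence fs \<longleftrightarrow>
     ideal_gen (set fs) \<noteq> UNIV \<and>
     (\<forall>i<length fs. \<forall>g. fs ! i * g \<in> ideal_gen (set (take i fs)) \<longrightarrow>
                        g \<in> ideal_gen (set (take i fs)))"

definition monomial_ideal :: "('x, 'k::field) mpoly set \<Rightarrow> bool" where
  "monomial_ideal M \<longleftrightarrow> (\<exists>G \<subseteq> monomials. M = ideal_gen G)"

definition minimally_generates :: "('x, 'k::field) mpoly set \<Rightarrow> ('x, 'k) mpoly set \<Rightarrow> bool" where
  "minimally_generates G M \<longleftrightarrow>
     G \<subseteq> monomials \<and> ideal_gen G = M \<and> (\<forall>H. H \<subset> G \<longrightarrow> ideal_gen H \<noteq> M)"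

text \<open>Uniqueness is lemma \<open>minimally_generates_unique\<close> below.\<close>

definition min_gens :: "('x, 'k::field) mpoly set \<Rightarrow> ('x, 'k) mpoly set" where
  "min_gens M = (THE G. minimally_generates G M)"

definition monomial_almost_complete_intersection ::
    "('x::finite, 'k::field) mpoly set \<Rightarrow> bool" where
  "monomial_almost_complete_intersection M \<longleftrightarrow>
     (\<exists>ls l. distinct (ls @ [l]) \<and> minimally_generates (set (ls @ [l])) M \<and> regular_sequence ls)"

definition dominant_in :: "('x, 'k::field) mpoly set \<Rightarrow> ('x, 'k) mpoly \<Rightarrow> bool" where
  "dominant_in G m \<longleftrightarrow>
     (\<exists>x k. k \<ge> 1 \<and> var x ^ k dvd m \<and> (\<forall>m' \<in> G - {m}. \<not> var x ^ k dvd m'))"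

definition dominant_set :: "('x, 'k::field) mpoly set \<Rightarrow> bool" where
  "dominant_set G \<longleftrightarrow> (\<forall>m\<in>G. dominant_in G m)"

definition semidominant_set :: "('x, 'k::field) mpoly set \<Rightarrow> bool" where
  "semidominant_set G \<longleftrightarrow> (\<exists>!m. m \<in> G \<and> \<not> dominant_in G m)"

definition dominant_ideal :: "('x, 'k::field) mpoly set \<Rightarrow> bool" where
  "dominant_ideal M \<longleftrightarrow> monomial_ideal M \<and> dominant_set (min_gens M)"

definition semidominant_ideal :: "('x, 'k::field) mpoly set \<Rightarrow> bool" where
  "semidominant_ideal M \<longleftrightarrow> monomial_ideal M \<and> semidominant_set (min_gens M)"

lemma module_times: "module ((*) :: 'a::comm_ring_1 \<Rightarrow> 'a \<Rightarrow> 'a)"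
  by standard (simp_all add: algebra_simps)

lemma keys_in_ideal_gen:
  fixes G :: "('x, 'k::field) mpoly set"
  assumes "f \<in> ideal_gen G" "G \<subseteq> monomials" "s \<in> Poly_Mapping.keys f"
  shows "\<exists>t u. Poly_Mapping.single t 1 \<in> G \<and> s = u + t"
  using assms(1) assms(3) unfolding ideal_gen_def
proof (induction arbitrary: s rule: module.span_induct_alt[OF module_times, consumes 1])
  case 1
  then show ?case by simp
next
  case (2 c x y)
  note IH = 2(2)
  from \<open>x \<in> G\<close> assms(2) obtain t where x: "x = Poly_Mapping.single t 1"
    unfolding monomials_def by blast
  from 2(3) consider "s \<in> Poly_Mapping.keys (c * x)" | "s \<in> Poly_Mapping.keys y"
    using Poly_Mapping.keys_add[of "c * x" y] by blast
  then show ?case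
  proof cases
    case 1
    then obtain u v where "s = u + v" "v \<in> Poly_Mapping.keys x"
      using keys_mult[of c x] by blast
    then show ?thesis using x \<open>x \<in> G\<close> by auto
  next
    case 2
    then show ?thesis using IH by blast
  qed
qed

lemma minimally_generates_antichain:
  fixes G :: "('x, 'k::field) mpoly set"
  assumes "minimally_generates G M"
    and a: "Poly_Mapping.single t 1 \<in> G" and b: "Poly_Mapping.single (u + t) 1 \<in> G"
  shows "u = 0"
proof (rule ccontr)
  assume "u \<noteq> 0"
  let ?g = "Poly_Mapping.single (u + t) 1 :: ('x, 'k) mpoly"
  let ?H = "G - {?g}"
  have "Poly_Mapping.single t 1 \<noteq> ?g"
    using \<open>u \<noteq> 0\<close> by (metis add_cancel_left_left lookup_single_eq lookup_single_not_eq one_neq_zero)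
  then have "Poly_Mapping.single t 1 \<in> module.span (*) ?H"
    using a by (simp add: module.span_base[OF module_times])
  then have "Poly_Mapping.single u 1 * Poly_Mapping.single t 1 \<in> module.span (*) ?H"
    by (rule module.span_scale[OF module_times])
  then have "?g \<in> module.span (*) ?H"
    by (simp add: mult_single)
  then have "G \<subseteq> module.span (*) ?H"
    using module.span_base[OF module_times, of _ ?H] by blast
  then have "module.span (*) G \<subseteq> module.span (*) ?H"
    by (simp add: module.span_minimal[OF module_times] module.subspace_span[OF module_times])
  moreover have "module.span (*) ?H \<subseteq> module.span (*) G"
    by (rule module.span_mono[OF module_times]) blast
  ultimately have "ideal_gen ?H = ideal_gen G"
    unfolding ideal_gen_def by blast
  moreover have "?H \<subset> G" using b by blast
  ultimately show False using assms(1) unfolding minimally_generates_def by blast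
qed

lemma minimally_generates_unique:
  fixes G H :: "('x, 'k::field) mpoly set"
  assumes "minimally_generates G M" "minimally_generates H M"
  shows "G = H"
proof -
  have sub: "A \<subseteq> B" if A: "minimally_generates A M" and B: "minimally_generates B M"
    for A B :: "('x, 'k) mpoly set"
  proof
    have div: "\<exists>t u. Poly_Mapping.single t 1 \<in> D \<and> s = u + t"
      if "minimally_generates C M" "minimally_generates D M" "Poly_Mapping.single s 1 \<in> C"
      for C D :: "('x, 'k) mpoly set" and s
    proof (rule keys_in_ideal_gen)
      have "Poly_Mapping.single s 1 \<in> ideal_gen C"
        unfolding ideal_gen_def using that(3) by (rule module.span_base[OF module_times])
      then show "Poly_Mapping.single s 1 \<in> ideal_gen D"
        using that(1,2) by (simp add: minimally_generates_def)
      show "D \<subseteq> monomials" using that(2) by (simp add: minimally_generates_def)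
    qed simp
    fix a assume "a \<in> A"
    then obtain s where s: "a = Poly_Mapping.single s 1"
      using A unfolding minimally_generates_def monomials_def by blast
    with \<open>a \<in> A\<close> obtain t u where t: "Poly_Mapping.single t 1 \<in> B" "s = u + t"
      using div[OF A B] by blast
    obtain t' u' where t': "Poly_Mapping.single t' 1 \<in> A" "t = u' + t'"
      using div[OF B A t(1)] by blast
    have "s = (u + u') + t'" using t(2) t'(2) by (simp add: add.assoc)
    then have "u + u' = 0"
      using minimally_generates_antichain[OF A t'(1)] \<open>a \<in> A\<close> s by blast
    then have "u = 0"
      by (intro poly_mapping_eqI) (metis add_is_0 lookup_add lookup_zero)
    then show "a \<in> B" using s t by simp
  qed
  show ?thesis using sub[OF assms] sub[OF assms(2,1)] by blast
qed

lemma min_gens_eq: "minimally_generates G M \<Longrightarrow> min_gens M = G"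
  unfolding min_gens_def by (rule the_equality) (assumption, erule (1) minimally_generates_unique)

end

theory Submission
  imports Defs
begin

text \<open>
  Let \<open>l\<^sub>1, \<dots>, l\<^sub>q, l\<close> be the minimal generators of \<open>M\<close>, with \<open>l\<^sub>1, \<dots>, l\<^sub>q\<close> a regular
  sequence. Each \<open>l\<^sub>i\<close> is dominant, so that \<open>l\<close> is the only generator which can fail to be: by
  minimality \<open>l\<^sub>i\<close> does not divide \<open>l\<close>, so some variable \<open>x\<close> has a larger exponent \<open>k\<close> in
  \<open>l\<^sub>i\<close> than in \<open>l\<close>; since \<open>x\<close> occurs in no other \<open>l\<^sub>j\<close>, the power \<open>x\<^sup>k\<close> divides \<open>l\<^sub>i\<close> and no
  other generator.

  That no variable is shared by two members of the regular sequence is the lemma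
  \<open>regular_sequence_monomials_disjoint\<close>. It rests on the fact that a monomial lies in a
  monomial ideal only if one of the generators divides it (\<open>keys_in_ideal_gen\<close>).
\<close>

lemma single_dvd_single_iff:
  "Poly_Mapping.single s 1 dvd (Poly_Mapping.single t 1 :: ('x, 'k::field) mpoly)
     \<longleftrightarrow> (\<forall>x. Poly_Mapping.lookup s x \<le> Poly_Mapping.lookup t x)"
proof
  assume "Poly_Mapping.single s 1 dvd (Poly_Mapping.single t 1 :: ('x, 'k) mpoly)"
  then obtain c :: "('x, 'k) mpoly"
    where "Poly_Mapping.single t 1 = Poly_Mapping.single s 1 * c" ..
  then have "t \<in> Poly_Mapping.keys (Poly_Mapping.single s 1 * c)"
    by (metis keys_single one_neq_zero singletonI)
  then obtain v where "t = s + v"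
    using keys_mult[of "Poly_Mapping.single s 1" c] by (auto split: if_splits)
  then show "\<forall>x. Poly_Mapping.lookup s x \<le> Poly_Mapping.lookup t x"
    by (simp add: lookup_add)
next
  assume "\<forall>x. Poly_Mapping.lookup s x \<le> Poly_Mapping.lookup t x"
  then have "t = s + (t - s)"
    by (intro poly_mapping_eqI) (simp add: lookup_add lookup_minus)
  then have "Poly_Mapping.single t (1::'k)
      = Poly_Mapping.single s 1 * Poly_Mapping.single (t - s) 1"
    by (simp add: mult_single)
  then show "Poly_Mapping.single s 1 dvd (Poly_Mapping.single t 1 :: ('x, 'k) mpoly)" ..
qed

lemma var_power: "var x ^ k = Poly_Mapping.single (Poly_Mapping.single x k) 1"
  by (induction k) (simp_all add: var_def mult_single single_add[symmetric])

lemma var_power_dvd_single_iff: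
  "var x ^ k dvd (Poly_Mapping.single t 1 :: ('x, 'k::field) mpoly)
     \<longleftrightarrow> k \<le> Poly_Mapping.lookup t x"
  unfolding var_power single_dvd_single_iff by (auto simp: lookup_single when_def)

lemma minimally_generates_dvd_imp_eq:
  fixes G :: "('x, 'k::field) mpoly set"
  assumes "minimally_generates G M"
    and "Poly_Mapping.single s 1 \<in> G" "Poly_Mapping.single t 1 \<in> G"
    and le: "\<And>x. Poly_Mapping.lookup s x \<le> Poly_Mapping.lookup t x"
  shows "s = t"
proof -
  have eq: "t = (t - s) + s"
    by (rule poly_mapping_eqI) (simp add: lookup_add lookup_minus le)
  then have "t - s = 0"
    using minimally_generates_antichain[OF assms(1,2), of "t - s"] assms(3) by simp
  with eq show ?thesis by simp
qed

text \<open>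
  If \<open>x\<close> divided both \<open>l\<^sub>i\<close> and a later \<open>l\<^sub>j\<close>, then \<open>l\<^sub>j (l\<^sub>i / x) = (l\<^sub>j / x) l\<^sub>i\<close> would lie in the
  ideal generated by \<open>l\<^sub>1, \<dots>, l\<^sub>j\<^sub>-\<^sub>1\<close>. By regularity so would \<open>l\<^sub>i / x\<close>, which is then divisible by
  some \<open>l\<^sub>h\<close>; hence \<open>l\<^sub>h\<close> properly divides \<open>l\<^sub>i\<close>, against minimality.
\<close>

lemma regular_sequence_monomials_disjoint:
  fixes G :: "('x, 'k::field) mpoly set"
  assumes min: "minimally_generates G M" and sub: "set ls \<subseteq> G" and reg: "regular_sequence ls"
    and ij: "i < j" "j < length ls"
    and s: "ls ! i = Poly_Mapping.single s 1" and t: "ls ! j = Poly_Mapping.single t 1"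
  shows "Poly_Mapping.lookup s x = 0 \<or> Poly_Mapping.lookup t x = 0"
proof (rule ccontr)
  assume "\<not> ?thesis"
  then have pos: "Poly_Mapping.lookup s x \<ge> 1" "Poly_Mapping.lookup t x \<ge> 1" by auto
  define e where "e = Poly_Mapping.single x (1::nat)"
  define g :: "('x, 'k) mpoly" where "g = Poly_Mapping.single (s - e) 1"
  have se: "s = (s - e) + e" and te: "t = (t - e) + e"
    using pos by (auto intro!: poly_mapping_eqI
        simp: e_def lookup_add lookup_minus lookup_single when_def)
  have prefix: "set (take j ls) \<subseteq> G" using sub set_take_subset by fast
  have mons: "G \<subseteq> monomials" using min by (simp add: minimally_generates_def)
  have "ls ! i \<in> set (take j ls)"
    using ij by (auto simp: in_set_conv_nth intro!: exI[of _ i])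
  then have base: "Poly_Mapping.single s 1 \<in> ideal_gen (set (take j ls))"
    unfolding ideal_gen_def s by (rule module.span_base[OF module_times])
  have "t + (s - e) = (t - e) + s"
    by (subst te, subst (2) se) (simp add: ac_simps)
  then have "ls ! j * g = Poly_Mapping.single (t - e) 1 * Poly_Mapping.single s 1"
    by (simp add: t g_def mult_single)
  also have "\<dots> \<in> ideal_gen (set (take j ls))"
    using base unfolding ideal_gen_def by (rule module.span_scale[OF module_times])
  finally have "g \<in> ideal_gen (set (take j ls))"
    using reg ij(2) unfolding regular_sequence_def by blast
  moreover have "s - e \<in> Poly_Mapping.keys g" by (simp add: g_def)
  ultimately obtain r u where r: "Poly_Mapping.single r 1 \<in> set (take j ls)" "s - e = u + r"
    using keys_in_ideal_gen[of g "set (take j ls)" "s - e"] prefix mons by blast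
  have "s = (u + e) + r" using se r(2) by (metis add.assoc add.commute)
  moreover have "Poly_Mapping.single s 1 \<in> G" using sub s ij by (metis nth_mem order.strict_trans subsetD)
  ultimately have "u + e = 0"
    using minimally_generates_antichain[OF min] r(1) prefix by blast
  then have "Poly_Mapping.lookup (u + e) x = 0" by simp
  then show False by (simp add: e_def lookup_add)
qed

lemma dominant_in_almost_complete_intersection:
  fixes ls :: "('x, 'k::field) mpoly list"
  assumes dist: "distinct (ls @ [l])" and min: "minimally_generates (set (ls @ [l])) M"
    and reg: "regular_sequence ls" and m: "m \<in> set ls"
  shows "dominant_in (set (ls @ [l])) m"
proof -
  let ?G = "set (ls @ [l])"
  have mons: "?G \<subseteq> monomials" using min by (simp add: minimally_generates_def)
  obtain t where t: "m = Poly_Mapping.single t 1" using mons m by (auto simp: monomials_def)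
  obtain s where s: "l = Poly_Mapping.single s 1" using mons by (auto simp: monomials_def)
  have "m \<noteq> l" using dist m by auto
  then have "t \<noteq> s" using t s by auto
  then obtain x where x: "Poly_Mapping.lookup t x > Poly_Mapping.lookup s x"
    using minimally_generates_dvd_imp_eq[OF min, of t s] t s m by (auto simp: not_le[symmetric])
  let ?k = "Poly_Mapping.lookup t x"
  have "\<not> var x ^ ?k dvd m'" if m': "m' \<in> ?G - {m}" for m'
  proof (cases "m' = l")
    case True
    then show ?thesis using x by (simp add: s var_power_dvd_single_iff)
  next
    case False
    obtain r where r: "m' = Poly_Mapping.single r 1" using mons m' by (auto simp: monomials_def)
    obtain i where i: "i < length ls" "ls ! i = m" using m by (auto simp: in_set_conv_nth)
    obtain j where j: "j < length ls" "ls ! j = m'"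
      using m' False by (auto simp: in_set_conv_nth)
    have sub: "set ls \<subseteq> ?G" by auto
    have "i \<noteq> j" using m' i j by auto
    then have "Poly_Mapping.lookup r x = 0"
      using regular_sequence_monomials_disjoint[OF min sub reg, of i j t r x]
        regular_sequence_monomials_disjoint[OF min sub reg, of j i r t x] i j t r x
      by (auto simp: neq_iff)
    then show ?thesis using x by (simp add: r var_power_dvd_single_iff)
  qed
  moreover have "var x ^ ?k dvd m" by (simp add: t var_power_dvd_single_iff)
  ultimately show ?thesis
    unfolding dominant_in_def using x by (intro exI[of _ x] exI[of _ ?k]) auto
qed

theorem proposition5p3:
  fixes M :: "('x::finite, 'k::field) mpoly set"
  assumes "monomial_almost_complete_intersection M"
  shows "dominant_ideal M \<or> semidominant_ideal M"
proof -
  obtain ls l where dist: "distinct (ls @ [l])"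
    and min: "minimally_generates (set (ls @ [l])) M" and reg: "regular_sequence ls"
    using assms unfolding monomial_almost_complete_intersection_def by blast
  let ?G = "set (ls @ [l])"
  have gens: "min_gens M = ?G" by (rule min_gens_eq[OF min])
  have ideal: "monomial_ideal M"
    using min unfolding minimally_generates_def monomial_ideal_def by blast
  have dom: "dominant_in ?G m" if "m \<in> set ls" for m
    using dominant_in_almost_complete_intersection[OF dist min reg that] .
  show ?thesis
  proof (cases "dominant_in ?G l")
    case True
    then have "dominant_set ?G" using dom unfolding dominant_set_def by auto
    then show ?thesis using ideal gens by (simp add: dominant_ideal_def)
  next
    case False
    then have "semidominant_set ?G"
      using dom unfolding semidominant_set_def by (intro ex1I[of _ l]) auto
    then show ?thesis using ideal gens by (simp add: semidominant_ideal_def)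
  qed
qed

end
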